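(* Let $S$ be a left cancellative monoid with neutral element $e$, and let $R$ be a ring with an $S$-grading $\Gamma: R=\bigoplus_{g\in S}R_g$ of finite support. If $R_e$ is nil and $\mathsf{f}$-commutative, then $R$ is nil. In addition, if $R_e$ is ($\mathsf{f}$-commutative and) nil of bounded index, then $R$ is nil of bounded index.
   Context: Rings are associative, not necessarily with unity. A monoid $S$ is left cancellative if $gh=gt$ implies $h=t$ for all $g,h,t\in S$. An $S$-grading on $R$ is a decomposition $\Gamma: R=\bigoplus_{g\in S}R_g$ into additive subgroups with $R_gR_h\subseteq R_{gh}$ for all $g,h\in S$; its support is $\{g\in S: R_g\neq 0\}$. A ring is nil if each of its elements is nilpotent; it is nil of bounded index if there is a single $n>0$ with $b^n=0$ for all its elements $b$. A left action of a semigroup $\mathfrak{S}$ on a ring $T$ is a map $\mathfrak{S}\times T\to T$, $(\lambda,x)\mapsto\lambda\cdot x$, with $(\lambda\gamma)\cdot x=\lambda\cdot(\gamma\cdot x)$ and $\lambda\cdot(xy)=(\lambda\cdot x)y$ for all $\lambda,\gamma\in\mathfrak{S}$, $x,y\in T$. A ring $T$ is $\mathsf{f}$-commutative if there exist a semigroup $\mathfrak{S}$ acting on the left of $T$ in this sense and a map $\mathsf{f}:T\times T\to\mathfrak{S}$ such that $ab=\mathsf{f}(a,b)\cdot(ba)$ for all $a,b\in T$. *)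

theory Defs
  imports Main
begin

text \<open>
  Rings are types of class \<^class>\<open>ring\<close>, i.e. associative and not necessarily unital.
  The neutral component of a grading is a ring inside \<open>R\<close>; hence the notions for
  rings below are relativised to a subset \<open>T\<close> of the ambient type, meant to be a subring.
\<close>

definition add_subgroup :: "'r::ring set \<Rightarrow> bool" where
  "add_subgroup A \<longleftrightarrow>
     0 \<in> A \<and> (\<forall>x\<in>A. \<forall>y\<in>A. x + y \<in> A) \<and> (\<forall>x\<in>A. - x \<in> A)"

definition grading :: "('s::monoid_mult \<Rightarrow> 'r::ring set) \<Rightarrow> bool" where
  "grading R \<longleftrightarrow>
     (\<forall>g. add_subgroup (R g)) \<and>
     (\<forall>r. \<exists>!x :: 's \<Rightarrow> 'r.
        (\<forall>g. x g \<in> R g) \<and> finite {g. x g \<noteq> 0} \<and> r = (\<Sum>g | x g \<noteq> 0. x g)) \<and>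
     (\<forall>g h. \<forall>x \<in> R g. \<forall>y \<in> R h. x * y \<in> R (g * h))"

definition grading_support :: "('s \<Rightarrow> 'r::ring set) \<Rightarrow> 's set" where
  "grading_support R = {g. R g \<noteq> {0}}"

text \<open>The power \<open>x\<^sup>n\<close> for \<open>n > 0\<close> without using a unit; the value at \<open>n = 0\<close> is junk.\<close>

definition pos_power :: "'r::ring \<Rightarrow> nat \<Rightarrow> 'r" where
  "pos_power x n = (((*) x) ^^ (n - 1)) x"

definition nil :: "'r::ring set \<Rightarrow> bool" where
  "nil T \<longleftrightarrow> (\<forall>b\<in>T. \<exists>n>0. pos_power b n = 0)"

definition nil_bounded :: "'r::ring set \<Rightarrow> bool" where
  "nil_bounded T \<longleftrightarrow> (\<exists>n>0. \<forall>b\<in>T. pos_power b n = 0)"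

definition left_action :: "'r::ring set \<Rightarrow> ('c::semigroup_mult \<Rightarrow> 'r \<Rightarrow> 'r) \<Rightarrow> bool" where
  "left_action T act \<longleftrightarrow>
     (\<forall>l. \<forall>x\<in>T. act l x \<in> T) \<and>
     (\<forall>l m. \<forall>x\<in>T. act (l * m) x = act l (act m x)) \<and>
     (\<forall>l. \<forall>x\<in>T. \<forall>y\<in>T. act l (x * y) = act l x * y)"

text \<open>
  HOL cannot quantify existentially over the type carrying the acting semigroup, so that type
  is a parameter. When \<open>f_commutative\<close> is a hypothesis of a theorem in which \<open>'c\<close> is a free type
  variable, this amounts to the existence of some semigroup.
\<close>

definition f_commutative :: "'c::semigroup_mult itself \<Rightarrow> 'r::ring set \<Rightarrow> bool" where
  "f_commutative (_ :: 'c itself) T \<longleftrightarrow>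
     (\<exists>(act :: 'c \<Rightarrow> 'r \<Rightarrow> 'r) (f :: 'r \<Rightarrow> 'r \<Rightarrow> 'c).
        left_action T act \<and> (\<forall>a\<in>T. \<forall>b\<in>T. a * b = act (f a b) (b * a)))"

end

theory Submission
  imports Defs "HOL-Library.Multiset"
begin

text \<open>
  Write \<open>r = \<Sum>g. x g\<close> with \<open>x g\<close> homogeneous of degree \<open>g\<close>; then \<open>r\<^sup>n\<close> is a sum of products
  \<open>x g\<^sub>1 \<dots> x g\<^sub>n\<close>. Such a product vanishes unless the walk of its prefix degrees
  \<open>g\<^sub>1 \<dots> g\<^sub>i\<close> stays in the support. Cut a word at the returns of its walk to the starting point:
  by left cancellation the pieces have degree \<open>1\<close>, and inside a piece the walk visits one value
  fewer, so by induction on the number of values the nonvanishing pieces have bounded length.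
  Hence there are only finitely many such pieces, and a long word contains one of them many times.
  In an \<open>f\<close>-commutative ring the vanishing of a product does not depend on the order of the
  factors, so the repeated piece \<open>b\<close> can be collected into a vanishing power \<open>b\<^sup>n\<close>.
\<close>

section \<open>Products of nonempty lists\<close>

text \<open>There is no unit, so the value on the empty list is junk.\<close>

fun pos_prod :: "'r::ring list \<Rightarrow> 'r" where
  "pos_prod [] = 0"
| "pos_prod [a] = a"
| "pos_prod (a # b # bs) = a * pos_prod (b # bs)"

lemma pos_prod_Cons: "bs \<noteq> [] \<Longrightarrow> pos_prod (a # bs) = a * pos_prod bs"
  by (cases bs) auto

lemma pos_prod_append:
  "us \<noteq> [] \<Longrightarrow> vs \<noteq> [] \<Longrightarrow> pos_prod (us @ vs) = pos_prod us * pos_prod vs"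
  by (induction us rule: pos_prod.induct) (auto simp: pos_prod_Cons mult.assoc)

text \<open>The condition \<open>vs \<noteq> []\<close> excludes the conventional value
  \<open>pos_prod [] = 0\<close>, which says nothing about longer products.\<close>

lemma pos_prod_eq_0_infix:
  assumes "pos_prod vs = 0" "vs \<noteq> []"
  shows "pos_prod (us @ vs @ ws) = 0"
proof -
  have "pos_prod (vs @ ws) = 0"
    using assms by (cases "ws = []") (auto simp: pos_prod_append)
  then show ?thesis
    using assms by (cases "us = []") (auto simp: pos_prod_append)
qed

lemma pos_prod_concat:
  assumes "\<And>b. b \<in> set bs \<Longrightarrow> b \<noteq> []"
  shows "pos_prod (concat bs) = pos_prod (map pos_prod bs)"
  using assms
proof (induction bs)
  case (Cons b bs)
  show ?case
  proof (cases "bs = []")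
    case False
    then have "concat bs \<noteq> []"
      using Cons.prems by (cases bs) auto
    then show ?thesis
      using False Cons by (simp add: pos_prod_append pos_prod_Cons)
  qed simp
qed simp

lemma pos_power_eq_pos_prod:
  assumes "n > 0"
  shows "pos_power b n = pos_prod (replicate n b)"
proof -
  have "((*) b ^^ m) b = pos_prod (replicate (Suc m) b)" for m
    by (induction m) auto
  from this[of "n - 1"] assms show ?thesis
    by (simp add: pos_power_def)
qed

lemma pos_prod_sum_entry:
  "pos_prod (us @ (\<Sum>g\<in>A. f g) # vs) = (\<Sum>g\<in>A. pos_prod (us @ f g # vs))"
proof -
  have "pos_prod ((\<Sum>g\<in>A. f g) # vs) = (\<Sum>g\<in>A. pos_prod (f g # vs))"
    by (cases "vs = []") (auto simp: pos_prod_Cons sum_distrib_right)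
  then show ?thesis
    by (cases "us = []") (auto simp: pos_prod_append sum_distrib_left)
qed

text \<open>The factors \<open>r\<close> are expanded one at a time from the left.\<close>

lemma pos_power_sum_eq_0:
  assumes "n > 0" and r: "r = (\<Sum>g\<in>A. x g)"
    and zero: "\<And>w. set w \<subseteq> A \<Longrightarrow> length w = n \<Longrightarrow> pos_prod (map x w) = 0"
  shows "pos_power r n = 0"
proof -
  have "pos_prod (map x w @ replicate m r) = 0" if "set w \<subseteq> A" "length w + m = n" for w m
    using that
  proof (induction m arbitrary: w)
    case 0
    then show ?case using zero by simp
  next
    case (Suc m)
    have "pos_prod (map x w @ replicate (Suc m) r)
        = (\<Sum>g\<in>A. pos_prod (map x w @ x g # replicate m r))"
      using pos_prod_sum_entry[of "map x w" x A "replicate m r"] by (simp add: r)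
    also have "\<dots> = (\<Sum>g\<in>A. 0)"
    proof (rule sum.cong)
      fix g assume "g \<in> A"
      then show "pos_prod (map x w @ x g # replicate m r) = 0"
        using Suc.IH[of "w @ [g]"] Suc.prems by simp
    qed simp
    finally show ?case by simp
  qed
  from this[of "[]" n] show ?thesis
    using \<open>n > 0\<close> by (simp add: pos_power_eq_pos_prod)
qed

section \<open>Vanishing products in f-commutative rings\<close>

text \<open>Actions are not assumed additive; writing 0 as \<open>0 * 0\<close> and letting
  \<open>act l\<close> pass to the left factor gives the claim.\<close>

lemma left_action_0:
  assumes "left_action T act" "0 \<in> T"
  shows "act l 0 = 0"
proof -
  have "act l (0 * 0) = act l 0 * 0"
    using assms unfolding left_action_def by blast
  then show ?thesis by simp
qed

lemma f_commutative_mult_eq_0: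
  assumes "f_commutative TYPE('c::semigroup_mult) T" "0 \<in> T" "a \<in> T" "b \<in> T" "b * a = 0"
  shows "a * b = 0"
  using assms left_action_0 unfolding f_commutative_def by metis

text \<open>The action commutes with right multiplication, so the correction from swapping
  \<open>a\<close> and \<open>b\<close> acts on the whole product \<open>b * a * c\<close>, which is
  0.\<close>

lemma f_commutative_mult_eq_0_left:
  assumes fc: "f_commutative TYPE('c::semigroup_mult) T" and "0 \<in> T"
    and closed: "\<And>a b. a \<in> T \<Longrightarrow> b \<in> T \<Longrightarrow> a * b \<in> T"
    and T: "a \<in> T" "b \<in> T" "c \<in> T" and zero: "b * (a * c) = 0"
  shows "a * (b * c) = 0"
proof -
  obtain act :: "'c \<Rightarrow> 'a \<Rightarrow> 'a" and f
    where act: "left_action T act" and f: "\<And>a b. a \<in> T \<Longrightarrow> b \<in> T \<Longrightarrow> a * b = act (f a b) (b * a)"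
    using fc unfolding f_commutative_def by blast
  have "a * (b * c) = act (f a b) (b * a) * c"
    using f[OF T(1,2)] by (metis mult.assoc)
  also have "\<dots> = act (f a b) (b * a * c)"
    using act T closed unfolding left_action_def by metis
  also have "\<dots> = 0"
    using zero left_action_0[OF act \<open>0 \<in> T\<close>] by (simp add: mult.assoc)
  finally show ?thesis .
qed

lemma pos_prod_in:
  assumes "\<And>a b. a \<in> T \<Longrightarrow> b \<in> T \<Longrightarrow> a * b \<in> T" "set bs \<subseteq> T" "bs \<noteq> []"
  shows "pos_prod bs \<in> T"
  using assms(2,3) by (induction bs rule: pos_prod.induct) (auto intro: assms(1))

text \<open>Two moves preserve vanishing: rotating a word and swapping its first two blocks. The
  head \<open>b\<close> is rotated to the far end, the remaining letters are permuted by induction,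
  and \<open>b\<close> is rotated back and swapped past \<open>c1\<close>. The suffix
  \<open>us\<close> is there to hold the parked letters.\<close>

lemma f_commutative_pos_prod_perm:
  assumes fc: "f_commutative TYPE('c::semigroup_mult) T" and "0 \<in> T"
    and closed: "\<And>a b. a \<in> T \<Longrightarrow> b \<in> T \<Longrightarrow> a * b \<in> T"
    and T: "set bs \<subseteq> T" "set us \<subseteq> T"
    and mset: "mset bs = mset cs" and zero: "pos_prod (bs @ us) = 0"
  shows "pos_prod (cs @ us) = 0"
proof -
  have rotate: "pos_prod (vs @ us) = 0"
    if "pos_prod (us @ vs) = 0" "set us \<subseteq> T" "set vs \<subseteq> T" for us vs
  proof (cases "us = [] \<or> vs = []")
    case False
    then show ?thesis
      using that f_commutative_mult_eq_0[OF fc \<open>0 \<in> T\<close>, of "pos_prod vs" "pos_prod us"]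
      by (simp add: pos_prod_append pos_prod_in closed)
  qed (use that in auto)
  have swap: "pos_prod (vs @ us @ ws) = 0"
    if "pos_prod (us @ vs @ ws) = 0" "set us \<subseteq> T" "set vs \<subseteq> T" "set ws \<subseteq> T" for us vs ws
  proof (cases "us = [] \<or> vs = [] \<or> ws = []")
    case True
    then show ?thesis using that rotate[of us vs] by auto
  next
    case False
    then show ?thesis
      using that f_commutative_mult_eq_0_left
          [OF fc \<open>0 \<in> T\<close> closed, of "pos_prod vs" "pos_prod us" "pos_prod ws"]
      by (simp add: pos_prod_append pos_prod_in closed)
  qed
  show ?thesis
    using T mset zero
  proof (induction bs arbitrary: cs us)
    case (Cons b bs)
    have "b \<in> set cs"
      using Cons.prems(3) by (metis list.set_intros(1) set_mset_mset)
    then obtain c1 c2 where cs: "cs = c1 @ b # c2"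
      by (meson split_list)
    have mset: "mset bs = mset (c1 @ c2)"
      using Cons.prems(3) cs by simp
    then have sub: "set c1 \<subseteq> T" "set c2 \<subseteq> T"
      using Cons.prems(1) by (metis le_sup_iff set_append set_mset_mset set_subset_Cons subset_trans)+
    have "pos_prod (bs @ us @ [b]) = 0"
      using rotate[of "[b]" "bs @ us"] Cons.prems by simp
    then have "pos_prod ((c1 @ c2) @ us @ [b]) = 0"
      using Cons.IH[OF _ _ mset, of "us @ [b]"] Cons.prems by simp
    then have "pos_prod ([b] @ c1 @ c2 @ us) = 0"
      using rotate[of "c1 @ c2 @ us" "[b]"] Cons.prems sub by simp
    then show ?case
      using swap[of "[b]" c1 "c2 @ us"] Cons.prems sub cs by simp
  qed simp
qed

text \<open>A rearrangement with \<open>n\<close> copies of \<open>b\<close> in front contains the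
  vanishing block \<open>pos_power b n\<close>.\<close>

lemma f_commutative_pos_prod_count:
  assumes fc: "f_commutative TYPE('c::semigroup_mult) T" and "0 \<in> T"
    and closed: "\<And>a b. a \<in> T \<Longrightarrow> b \<in> T \<Longrightarrow> a * b \<in> T"
    and T: "set bs \<subseteq> T" and "n > 0" "pos_power b n = 0" "n \<le> count_list bs b"
  shows "pos_prod bs = 0"
proof -
  define cs where "cs = replicate n b @
    replicate (count_list bs b - n) b @ filter (\<lambda>c. c \<noteq> b) bs"
  have "mset cs = mset bs"
  proof (rule multiset_eqI)
    show "count (mset cs) c = count (mset bs) c" for c
      using \<open>n \<le> count_list bs b\<close> by (auto simp: cs_def count_mset)
  qed
  moreover have "pos_prod cs = 0"
    using pos_prod_eq_0_infix[of "replicate n b" "[]"] assms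
    by (simp add: cs_def pos_power_eq_pos_prod)
  ultimately show ?thesis
    using f_commutative_pos_prod_perm[OF fc \<open>0 \<in> T\<close> closed, of cs "[]" bs] T
    by (metis append_Nil2 empty_subsetI list.set(1) set_mset_mset)
qed

section \<open>Long words vanish\<close>

lemma pigeonhole_count_list:
  assumes "finite B" "set bs \<subseteq> B" "card B * n < length bs"
  obtains b where "b \<in> set bs" "n < count_list bs b"
proof (rule ccontr)
  assume "\<not> thesis"
  then have "count_list bs b \<le> n" for b
    using that by (metis count_list_0_iff not_le zero_le)
  then have "sum (count_list bs) B \<le> card B * n"
    using sum_bounded_above[of B "count_list bs" n] by simp
  then show False
    using assms by (simp add: sum_count_set)
qed

lemma length_concat_le:
  "(\<And>b. b \<in> set bs \<Longrightarrow> length b \<le> M) \<Longrightarrow> length (concat bs) \<le> length bs * M"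
  by (induction bs) (auto simp: add_mono)

lemma cut_at_returns:
  fixes s :: "'s::monoid_mult" and x :: "'s \<Rightarrow> 'r::ring"
  assumes left_cancel: "\<And>g h t :: 's. g * h = g * t \<Longrightarrow> h = t"
    and short: "\<And>t w. set w \<subseteq> A \<Longrightarrow> L < length w \<Longrightarrow>
      (\<And>i. i \<le> length w \<Longrightarrow> t * prod_list (take i w) \<in> P - {s}) \<Longrightarrow> pos_prod (map x w) = 0"
    and "set w \<subseteq> A" and "\<And>i. i \<le> length w \<Longrightarrow> s * prod_list (take i w) \<in> P"
    and "w = [] \<or> pos_prod (map x w) \<noteq> 0"
  shows "\<exists>bs t. w = concat bs @ t \<and> length t \<le> L + 2 \<and>
    (\<forall>b\<in>set bs. b \<noteq> [] \<and> prod_list b = 1 \<and> length b \<le> L + 2)"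
  using assms(3-)
proof (induction w rule: length_induct)
  case (1 w)
  note walk = 1(3)
  have bound: "j \<le> L + 2" if j: "j \<le> length w"
    and avoid: "\<And>i. 0 < i \<Longrightarrow> i < j \<Longrightarrow> s * prod_list (take i w) \<noteq> s" for j
  proof (rule ccontr)
    assume "\<not> j \<le> L + 2"
    then have "j > L + 2" by simp
    then obtain g v where w: "w = g # v"
      using j by (cases w) auto
    \<comment> \<open>Dropping the first and last of the \<open>j\<close> letters leaves a walk from
      \<open>s * g\<close> that avoids \<open>s\<close> at both ends too; this accounts for the 2 in
      \<open>L + 2\<close>.\<close>
    define v' where "v' = take (j - 2) v"
    have len: "length v' = j - 2"
      using j w by (simp add: v'_def)
    have "pos_prod (map x v') = 0"
    proof (rule short)
      show "set v' \<subseteq> A"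
        using 1(2) set_take_subset[of "j - 2" v] by (auto simp: v'_def w)
      show "L < length v'" using len \<open>j > L + 2\<close> by simp
      fix i assume "i \<le> length v'"
      then have i: "Suc i < j" using len \<open>j > L + 2\<close> by simp
      have "s * g * prod_list (take i v') = s * prod_list (take (Suc i) w)"
        using i by (simp add: v'_def w mult.assoc min_absorb1)
      then show "s * g * prod_list (take i v') \<in> P - {s}"
        using walk[of "Suc i"] avoid[of "Suc i"] i j by simp
    qed
    moreover have "w = [g] @ v' @ drop (j - 2) v"
      by (simp add: w v'_def)
    moreover have "v' \<noteq> []"
      using len \<open>j > L + 2\<close> by auto
    ultimately have "pos_prod (map x w) = 0"
      using pos_prod_eq_0_infix[of "map x v'" "[x g]" "map x (drop (j - 2) v)"]
      by (metis list.map_disc_iff list.simps(8) list.simps(9) map_append)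
    then show False using 1(4) w by simp
  qed
  show ?case
  proof (cases "\<exists>i. 0 < i \<and> i \<le> length w \<and> s * prod_list (take i w) = s")
    case False
    then have "length w \<le> L + 2"
      by (intro bound) (use less_imp_le in blast)+
    then show ?thesis
      by (intro exI[of _ "[]"] exI[of _ w]) simp
  next
    case True
    define i where "i = (LEAST i. 0 < i \<and> i \<le> length w \<and> s * prod_list (take i w) = s)"
    have i: "0 < i" "i \<le> length w" "s * prod_list (take i w) = s"
      using LeastI_ex[OF True] unfolding i_def by auto
    have "i \<le> L + 2"
    proof (rule bound)
      fix j assume j: "0 < j" "j < i"
      have "\<not> (0 < j \<and> j \<le> length w \<and> s * prod_list (take j w) = s)"
        using j(2) unfolding i_def by (rule not_less_Least)
      then show "s * prod_list (take j w) \<noteq> s"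
        using j i(2) by simp
    qed (rule i)
    \<comment> \<open>Cancel \<open>s\<close> in
      \<open>s * prod_list (take i w) = s * 1\<close>.\<close>
    have one: "prod_list (take i w) = 1"
      by (rule left_cancel[of s]) (use i(3) in simp)
    have "\<exists>bs t. drop i w = concat bs @ t \<and> length t \<le> L + 2 \<and>
      (\<forall>b\<in>set bs. b \<noteq> [] \<and> prod_list b = 1 \<and> length b \<le> L + 2)"
    proof (rule 1(1)[rule_format])
      show "length (drop i w) < length w" using i by simp
      show "set (drop i w) \<subseteq> A" using 1(2) set_drop_subset by fast
      \<comment> \<open>The removed piece has degree 1, so the remaining walk starts at
        \<open>s\<close> again and visits the same points as before.\<close>
      show "s * prod_list (take j (drop i w)) \<in> P" if "j \<le> length (drop i w)" for j
        using walk[of "i + j"] that i one by (simp add: take_add)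
      have "pos_prod (map x w) = 0" if "pos_prod (map x (drop i w)) = 0" "drop i w \<noteq> []"
        using pos_prod_eq_0_infix[of "map x (drop i w)" "map x (take i w)" "[]"] that
        by (metis append_Nil2 append_take_drop_id list.map_disc_iff map_append)
      then show "drop i w = [] \<or> pos_prod (map x (drop i w)) \<noteq> 0"
        using 1(4) by auto
    qed
    then obtain bs t where bs: "drop i w = concat bs @ t" "length t \<le> L + 2"
      "\<forall>b\<in>set bs. b \<noteq> [] \<and> prod_list b = 1 \<and> length b \<le> L + 2"
      by blast
    have "w = concat (take i w # bs) @ t"
      using bs(1) by (metis append_assoc append_take_drop_id concat.simps(2))
    moreover have "\<forall>b\<in>set (take i w # bs). b \<noteq> [] \<and> prod_list b = 1 \<and> length b \<le> L + 2"
      using bs(3) i one \<open>i \<le> L + 2\<close> by auto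
    ultimately show ?thesis
      using bs(2) by blast
  qed
qed

lemma pos_prod_homogeneous:
  assumes "grading R" "\<And>g. x g \<in> R g" "w \<noteq> []"
  shows "pos_prod (map x w) \<in> R (prod_list w)"
  using assms(3)
proof (induction w)
  case (Cons g w)
  then show ?case
    using assms(1,2) by (cases "w = []") (auto simp: pos_prod_Cons grading_def)
qed simp

text \<open>
  The set \<open>X\<close> of component families lets one statement serve both the nil case (one family)
  and the case of bounded index (all families).
\<close>

lemma long_walk_vanishes:
  fixes R :: "'s::monoid_mult \<Rightarrow> 'r::ring set"
  assumes left_cancel: "\<And>g h t :: 's. g * h = g * t \<Longrightarrow> h = t"
    and grading: "grading R"
    and "finite A"
    and f_comm: "f_commutative TYPE('c::semigroup_mult) (R 1)"
    and X: "\<And>x g. x \<in> X \<Longrightarrow> x g \<in> R g"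
    and nil: "\<And>w. w \<noteq> [] \<Longrightarrow> prod_list w = 1 \<Longrightarrow>
      \<exists>n>0. \<forall>x\<in>X. pos_power (pos_prod (map x w)) n = 0"
  shows "\<exists>L. \<forall>P s w x. finite P \<and> card P \<le> k \<and> x \<in> X \<and> set w \<subseteq> A \<and> L < length w \<and>
    (\<forall>i\<le>length w. s * prod_list (take i w) \<in> P) \<longrightarrow> pos_prod (map x w) = 0"
proof (induction k)
  case 0
  \<comment> \<open>Even the empty prefix visits \<open>s\<close>, so \<open>P\<close> cannot be
    empty.\<close>
  then show ?case by force
next
  case (Suc k)
  then obtain L where L: "\<forall>P s w x. finite P \<and> card P \<le> k \<and> x \<in> X \<and> set w \<subseteq> A \<and>
    L < length w \<and> (\<forall>i\<le>length w. s * prod_list (take i w) \<in> P) \<longrightarrow> pos_prod (map x w) = 0" ..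
  define B where "B = {w. set w \<subseteq> A \<and> length w \<le> L + 2}"
  have "finite B"
    unfolding B_def using \<open>finite A\<close> by (rule finite_lists_length_le)
  \<comment> \<open>The exponent depends on the word but is common to all families in
    \<open>X\<close>; this keeps the final bound uniform over \<open>X\<close>.\<close>
  obtain n where n: "\<And>w. w \<noteq> [] \<Longrightarrow> prod_list w = 1 \<Longrightarrow>
      n w > 0 \<and> (\<forall>x\<in>X. pos_power (pos_prod (map x w)) (n w) = 0)"
    using nil by metis
  \<comment> \<open>Since \<open>B\<close> is finite, the sum dominates every \<open>n b\<close>
    with \<open>b\<close> in \<open>B\<close>.\<close>
  define N where "N = sum n B"
  \<comment> \<open>The last summand pays for the tail; the rest forces more than
    \<open>card B * N\<close> pieces, so some piece occurs more than \<open>N\<close> times.\<close>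
  define L' where "L' = card B * N * (L + 2) + (L + 2)"
  have step: "pos_prod (map x w) = 0"
    if P: "finite P" "card P \<le> Suc k" and x: "x \<in> X" and w: "set w \<subseteq> A" "L' < length w"
      and walk: "\<And>i. i \<le> length w \<Longrightarrow> s * prod_list (take i w) \<in> P" for P s w x
  proof (rule ccontr)
    assume nz: "pos_prod (map x w) \<noteq> 0"
    have "s \<in> P" using walk[of 0] by simp
    then have card: "card (P - {s}) \<le> k"
      using P by simp
    have "\<exists>bs t. w = concat bs @ t \<and> length t \<le> L + 2 \<and>
      (\<forall>b\<in>set bs. b \<noteq> [] \<and> prod_list b = 1 \<and> length b \<le> L + 2)"
    proof (rule cut_at_returns[OF left_cancel, where A = A and P = P and s = s and x = x])
      show "pos_prod (map x v) = 0" if "set v \<subseteq> A" "L < length v"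
        "\<And>i. i \<le> length v \<Longrightarrow> t * prod_list (take i v) \<in> P - {s}" for t v
        using L[rule_format, of "P - {s}" x v t] card x that P by simp
    qed (use w walk nz in auto)
    then obtain bs t where bs: "w = concat bs @ t" "length t \<le> L + 2"
      "\<And>b. b \<in> set bs \<Longrightarrow> b \<noteq> [] \<and> prod_list b = 1 \<and> length b \<le> L + 2"
      by blast
    have "length w \<le> length bs * (L + 2) + (L + 2)"
      using length_concat_le[of bs "L + 2"] bs by simp
    then have "card B * N * (L + 2) < length bs * (L + 2)"
      using w(2) unfolding L'_def by linarith
    then have "card B * N < length bs"
      by (metis mult_less_cancel2)
    moreover have sub: "set bs \<subseteq> B"
      using w(1) bs(1,3) unfolding B_def by fastforce
    ultimately obtain b where b: "b \<in> set bs" "N < count_list bs b"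
      using pigeonhole_count_list[OF \<open>finite B\<close>] by metis
    have "n b \<le> N"
      unfolding N_def using b(1) sub \<open>finite B\<close> by (intro member_le_sum) auto
    define p where "p = (\<lambda>v. pos_prod (map x v))"
    \<comment> \<open>Only an inequality, since different words may have equal products.\<close>
    have "count_list bs b \<le> count_list (map p bs) (p b)"
      by (induction bs) auto
    then have "n b \<le> count_list (map p bs) (p b)"
      using \<open>n b \<le> N\<close> b(2) by linarith
    have "pos_prod (map p bs) = 0"
    proof (rule f_commutative_pos_prod_count[OF f_comm])
      show "0 \<in> R 1" using grading by (auto simp: grading_def add_subgroup_def)
      show "a * c \<in> R 1" if "a \<in> R 1" "c \<in> R 1" for a c
        using grading that unfolding grading_def by (metis mult_1)
      show "set (map p bs) \<subseteq> R 1"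
      proof
        fix a assume "a \<in> set (map p bs)"
        then obtain v where "v \<in> set bs" "a = p v" by auto
        then show "a \<in> R 1"
          using pos_prod_homogeneous[where x = x and w = v, OF grading X[OF x]] bs(3)[of v]
          by (simp add: p_def)
      qed
      show "0 < n b" "pos_power (p b) (n b) = 0"
        using n[of b] bs(3)[OF b(1)] x by (auto simp: p_def)
    qed fact
    moreover have "pos_prod (map x (concat bs)) = pos_prod (map p bs)"
      unfolding map_concat
      by (subst pos_prod_concat) (use bs(3) in \<open>auto simp: p_def comp_def\<close>)
    moreover have "concat bs \<noteq> []"
      using b(1) bs(3) by auto
    ultimately have "pos_prod (map x w) = 0"
      using pos_prod_eq_0_infix[of "map x (concat bs)" "[]" "map x t"] bs(1) by simp
    then show False using nz by simp
  qed
  show ?case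
  proof (intro exI[of _ L'] allI impI)
    fix P s w x
    assume "finite P \<and> card P \<le> Suc k \<and> x \<in> X \<and> set w \<subseteq> A \<and> L' < length w \<and>
      (\<forall>i\<le>length w. s * prod_list (take i w) \<in> P)"
    then show "pos_prod (map x w) = 0"
      using step[of P x w s] by simp
  qed
qed

lemma long_word_vanishes:
  fixes R :: "'s::monoid_mult \<Rightarrow> 'r::ring set"
  assumes left_cancel: "\<And>g h t :: 's. g * h = g * t \<Longrightarrow> h = t"
    and grading: "grading R"
    and finite_support: "finite (grading_support R)"
    and f_comm: "f_commutative TYPE('c::semigroup_mult) (R 1)"
    and X: "\<And>x g. x \<in> X \<Longrightarrow> x g \<in> R g"
    and nil: "\<And>w. w \<noteq> [] \<Longrightarrow> prod_list w = 1 \<Longrightarrow>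
      \<exists>n>0. \<forall>x\<in>X. pos_power (pos_prod (map x w)) n = 0"
  shows "\<exists>n>0. \<forall>x\<in>X. \<forall>w. set w \<subseteq> grading_support R \<longrightarrow> length w = n \<longrightarrow> pos_prod (map x w) = 0"
proof -
  \<comment> \<open>The walk starts at 1, which may lie outside the support. If it leaves
    \<open>P\<close>, a nonempty prefix has its product in a zero component.\<close>
  define P where "P = insert 1 (grading_support R)"
  have "\<exists>L. \<forall>P' s w x. finite P' \<and> card P' \<le> card P \<and> x \<in> X \<and>
    set w \<subseteq> grading_support R \<and> L < length w \<and>
    (\<forall>i\<le>length w. s * prod_list (take i w) \<in> P') \<longrightarrow> pos_prod (map x w) = 0"
    by (rule long_walk_vanishes[OF _ grading finite_support f_comm]) (fact left_cancel X nil)+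
  then obtain L where L: "\<forall>P' s w x. finite P' \<and> card P' \<le> card P \<and> x \<in> X \<and>
    set w \<subseteq> grading_support R \<and> L < length w \<and>
    (\<forall>i\<le>length w. s * prod_list (take i w) \<in> P') \<longrightarrow> pos_prod (map x w) = 0" ..
  have "pos_prod (map x w) = 0"
    if x: "x \<in> X" and w: "set w \<subseteq> grading_support R" "length w = Suc L" for x w
  proof (cases "\<forall>i\<le>length w. 1 * prod_list (take i w) \<in> P")
    case True
    then show ?thesis
      using L[rule_format, of P x w 1] finite_support x w by (simp add: P_def)
  next
    case False
    then obtain i where i: "prod_list (take i w) \<notin> P" by auto
    then have ne: "take i w \<noteq> []" by (metis P_def insertI1 prod_list.Nil)
    have "R (prod_list (take i w)) = {0}"
      using i by (auto simp: P_def grading_support_def)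
    then have "pos_prod (map x (take i w)) = 0"
      using pos_prod_homogeneous[OF grading X[OF x] ne] by simp
    then show ?thesis
      using pos_prod_eq_0_infix[of "map x (take i w)" "[]" "map x (drop i w)"] ne
      by (metis append_Nil append_take_drop_id list.map_disc_iff map_append)
  qed
  then show ?thesis by blast
qed

section \<open>From words back to ring elements\<close>

text \<open>Padding with zero components gives one finite index set for all
  \<open>r\<close>.\<close>

lemma grading_components:
  assumes "grading R" "finite (grading_support R)"
  obtains x where "\<And>g. x g \<in> R g" "r = (\<Sum>g\<in>grading_support R. x g)"
proof -
  obtain x where x: "\<forall>g. x g \<in> R g" "r = (\<Sum>g | x g \<noteq> 0. x g)"
    using assms(1) unfolding grading_def by metis
  have "(\<Sum>g | x g \<noteq> 0. x g) = (\<Sum>g\<in>grading_support R. x g)"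
    using x(1) assms(2) by (intro sum.mono_neutral_left) (auto simp: grading_support_def)
  then show ?thesis using that x by metis
qed

theorem theorem3p8:
  fixes R :: "'s::monoid_mult \<Rightarrow> 'r::ring set"
  assumes left_cancel: "\<And>g h t :: 's. g * h = g * t \<Longrightarrow> h = t"
    and grading: "grading R"
    and finite_support: "finite (grading_support R)"
    and f_comm: "f_commutative TYPE('c::semigroup_mult) (R 1)"
  shows "(nil (R 1) \<longrightarrow> nil (UNIV :: 'r set)) \<and>
         (nil_bounded (R 1) \<longrightarrow> nil_bounded (UNIV :: 'r set))"
proof (intro conjI impI)
  assume nil: "nil (R 1)"
  show "nil (UNIV :: 'r set)"
    unfolding nil_def
  proof
    fix r :: 'r
    obtain x where x: "\<And>g. x g \<in> R g" "r = (\<Sum>g\<in>grading_support R. x g)"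
      using grading_components[OF grading finite_support] by metis
    \<comment> \<open>With the single family \<open>x\<close>, the exponent may depend on
      \<open>r\<close>.\<close>
    have "\<exists>n>0. \<forall>y\<in>{x}. \<forall>w. set w \<subseteq> grading_support R \<longrightarrow> length w = n \<longrightarrow> pos_prod (map y w) = 0"
    proof (rule long_word_vanishes[OF left_cancel grading finite_support f_comm])
      show "\<exists>n>0. \<forall>y\<in>{x}. pos_power (pos_prod (map y w)) n = 0"
        if "w \<noteq> []" "prod_list w = 1" for w
        using nil pos_prod_homogeneous[where x = x, OF grading x(1) that(1)] that(2)
        by (auto simp: nil_def)
    qed (use x in auto)
    then show "\<exists>n>0. pos_power r n = 0"
      using pos_power_sum_eq_0[OF _ x(2)] by (metis singletonI)
  qed
next
  assume "nil_bounded (R 1)"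
  then obtain m where m: "m > 0" "\<forall>b\<in>R 1. pos_power b m = 0"
    by (auto simp: nil_bounded_def)
  \<comment> \<open>Taking all homogeneous families at once makes \<open>n\<close> independent of
    \<open>r\<close>; the index \<open>m\<close> of \<open>R 1\<close> serves every word of degree
    1.\<close>
  define X where "X = {x. \<forall>g. x g \<in> R g}"
  have "\<exists>n>0. \<forall>x\<in>X. \<forall>w. set w \<subseteq> grading_support R \<longrightarrow> length w = n \<longrightarrow> pos_prod (map x w) = 0"
  proof (rule long_word_vanishes[OF left_cancel grading finite_support f_comm])
    show "\<exists>n>0. \<forall>x\<in>X. pos_power (pos_prod (map x w)) n = 0"
      if "w \<noteq> []" "prod_list w = 1" for w
    proof (intro exI[of _ m] conjI ballI)
      fix x assume "x \<in> X"
      then have "pos_prod (map x w) \<in> R 1"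
        using pos_prod_homogeneous[of R x w] grading that by (simp add: X_def)
      then show "pos_power (pos_prod (map x w)) m = 0"
        using m by blast
    qed (rule m)
  qed (auto simp: X_def)
  then obtain n where n: "n > 0" "\<And>x w. x \<in> X \<Longrightarrow> set w \<subseteq> grading_support R \<Longrightarrow>
    length w = n \<Longrightarrow> pos_prod (map x w) = 0"
    by blast
  have "pos_power r n = 0" for r :: 'r
  proof -
    obtain x where x: "\<And>g. x g \<in> R g" "r = (\<Sum>g\<in>grading_support R. x g)"
      using grading_components[OF grading finite_support] by metis
    show ?thesis
      using pos_power_sum_eq_0[OF n(1) x(2)] n(2)[of x] x(1) by (simp add: X_def)
  qed
  then show "nil_bounded (UNIV :: 'r set)"
    using n(1) by (auto simp: nil_bounded_def)
qed

end
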